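(* Let $T \in \mathbb{N}$ and let $\mathcal{M}_2$ be the set of all $2$-armed rising deterministic rested bandits $\boldsymbol{\mu} = (\mu_1,\mu_2)$. Then, for every learning policy $\pi$, $$\sup_{\boldsymbol{\mu} \in \mathcal{M}_2} R_{\boldsymbol{\mu}}(\pi, T) \ge \left\lfloor \frac{T}{64} \right\rfloor .$$
   Context: Setting: $\mathbb{N} = \{1,2,\dots\}$, $[K] = \{1,\dots,K\}$. A deterministic rested $K$-armed bandit is a vector $\boldsymbol{\mu} = (\mu_i)_{i\in[K]}$ of functions $\mu_i : \mathbb{N} \to [0,1]$. At each round $t \in [T]$ the agent selects an arm $I_t \in [K]$ and observes the reward $R_t = \mu_{I_t}(N_{I_t,t})$, where $N_{i,t} = \sum_{l=1}^t \mathbf{1}\{I_l = i\}$ is the number of pulls of arm $i$ up to and including round $t$. A learning policy $\pi$ is a function mapping each history $\mathcal{H}_{t-1} = (I_l,R_l)_{l=1}^{t-1}$ to an arm $I_t$ (it may depend on $T$). Its expected cumulative reward is $J_{\boldsymbol{\mu}}(\pi,T) = \mathbb{E}_{\boldsymbol{\mu},\pi}\big[\sum_{t=1}^T \mu_{I_t}(N_{I_t,t})\big]$, and its expected cumulative regret is $R_{\boldsymbol{\mu}}(\pi,T) = \sup_{\pi'} J_{\boldsymbol{\mu}}(\pi',T) - J_{\boldsymbol{\mu}}(\pi,T)$, where $\pi'$ ranges over all policies (including those that know $\boldsymbol{\mu}$). Increments: $\gamma_i(n) = \mu_i(n+1) - \mu_i(n)$. The bandit is rising if, for all $i \in [K]$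 and $n \in \mathbb{N}$, $\gamma_i(n) \ge 0$ (non-decreasing) and $\gamma_i(n+1) \le \gamma_i(n)$ (concave). *)

theory Defs
  imports Complex_Main
begin

text \<open>
  A \<open>K\<close>-armed bandit is a function \<open>\<mu>\<close> with \<open>\<mu> i n\<close> the reward of the \<open>n\<close>-th pull of arm \<open>i\<close>;
  arms range over \<open>{1..K}\<close> and pull numbers over \<open>n \<ge> 1\<close>, and the values of \<open>\<mu>\<close> elsewhere are
  never used.
\<close>

type_synonym bandit = "nat \<Rightarrow> nat \<Rightarrow> real"
type_synonym history = "(nat \<times> real) list"  \<comment> \<open>arm and observed reward of each round, oldest first\<close>
type_synonym policy = "history \<Rightarrow> nat"

definition deterministic_bandit :: "nat \<Rightarrow> bandit \<Rightarrow> bool" where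
  "deterministic_bandit K \<mu> \<longleftrightarrow> (\<forall>i\<in>{1..K}. \<forall>n\<ge>1. 0 \<le> \<mu> i n \<and> \<mu> i n \<le> 1)"

definition increment :: "bandit \<Rightarrow> nat \<Rightarrow> nat \<Rightarrow> real" where
  "increment \<mu> i n = \<mu> i (n + 1) - \<mu> i n"

definition rising :: "nat \<Rightarrow> bandit \<Rightarrow> bool" where
  "rising K \<mu> \<longleftrightarrow>
     (\<forall>i\<in>{1..K}. \<forall>n\<ge>1. 0 \<le> increment \<mu> i n \<and> increment \<mu> i (n + 1) \<le> increment \<mu> i n)"

definition rising_bandits :: "nat \<Rightarrow> bandit set" where
  "rising_bandits K = {\<mu>. deterministic_bandit K \<mu> \<and> rising K \<mu>}"

definition policies :: "nat \<Rightarrow> policy set" where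
  "policies K = {\<pi>. \<forall>h. \<pi> h \<in> {1..K}}"

definition pulls :: "nat \<Rightarrow> history \<Rightarrow> nat" where
  "pulls i h = count_list (map fst h) i"

text \<open>\<open>history \<mu> \<pi> t\<close> is the history after \<open>t\<close> rounds; the arm chosen in a round is pulled for the
  \<open>(pulls i h + 1)\<close>-st time.\<close>

primrec history :: "bandit \<Rightarrow> policy \<Rightarrow> nat \<Rightarrow> history" where
  "history \<mu> \<pi> 0 = []"
| "history \<mu> \<pi> (Suc t) =
     (let h = history \<mu> \<pi> t; i = \<pi> h in h @ [(i, \<mu> i (pulls i h + 1))])"

definition chosen_arm :: "bandit \<Rightarrow> policy \<Rightarrow> nat \<Rightarrow> nat" where
  "chosen_arm \<mu> \<pi> t = \<pi> (history \<mu> \<pi> (t - 1))"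

definition num_pulls :: "bandit \<Rightarrow> policy \<Rightarrow> nat \<Rightarrow> nat \<Rightarrow> nat" where
  "num_pulls \<mu> \<pi> i t = card {l \<in> {1..t}. chosen_arm \<mu> \<pi> l = i}"

text \<open>Bandit and policy are both deterministic, so the interaction has a single trajectory and the
  expectation in the cumulative reward is the value on that trajectory.\<close>

definition cumulative_reward :: "bandit \<Rightarrow> policy \<Rightarrow> nat \<Rightarrow> real" where
  "cumulative_reward \<mu> \<pi> T =
     (\<Sum>t = 1..T. \<mu> (chosen_arm \<mu> \<pi> t) (num_pulls \<mu> \<pi> (chosen_arm \<mu> \<pi> t) t))"

definition regret :: "nat \<Rightarrow> bandit \<Rightarrow> policy \<Rightarrow> nat \<Rightarrow> real" where
  "regret K \<mu> \<pi> T =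
     (SUP \<pi>'\<in>policies K. cumulative_reward \<mu> \<pi>' T) - cumulative_reward \<mu> \<pi> T"

lemma pulls_history: "pulls i (history \<mu> \<pi> t) = num_pulls \<mu> \<pi> i t"
proof (induction t)
  case 0
  then show ?case by (simp add: pulls_def num_pulls_def)
next
  case (Suc t)
  have "{l \<in> {1..Suc t}. chosen_arm \<mu> \<pi> l = i} =
        {l \<in> {1..t}. chosen_arm \<mu> \<pi> l = i} \<union> (if chosen_arm \<mu> \<pi> (Suc t) = i then {Suc t} else {})"
    by (auto simp: le_Suc_eq)
  then have "num_pulls \<mu> \<pi> i (Suc t) =
             num_pulls \<mu> \<pi> i t + (if chosen_arm \<mu> \<pi> (Suc t) = i then 1 else 0)"
    by (auto simp: num_pulls_def)
  with Suc show ?case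
    by (simp add: Let_def pulls_def chosen_arm_def)
qed

text \<open>The reward recorded in the history is the one summed in the cumulative reward.\<close>

lemma history_Suc:
  "history \<mu> \<pi> (Suc t) = history \<mu> \<pi> t @
     [(chosen_arm \<mu> \<pi> (Suc t), \<mu> (chosen_arm \<mu> \<pi> (Suc t)) (num_pulls \<mu> \<pi> (chosen_arm \<mu> \<pi> (Suc t)) (Suc t)))]"
  by (simp add: Let_def chosen_arm_def pulls_def flip: pulls_history)

text \<open>The suprema over policies and over bandits are taken over bounded sets of reals.\<close>

lemma cumulative_reward_bounds:
  assumes "deterministic_bandit K \<mu>" "\<pi> \<in> policies K"
  shows "0 \<le> cumulative_reward \<mu> \<pi> T" "cumulative_reward \<mu> \<pi> T \<le> real T"
proof -
  have *: "0 \<le> \<mu> (chosen_arm \<mu> \<pi> t) (num_pulls \<mu> \<pi> (chosen_arm \<mu> \<pi> t) t) \<and>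
           \<mu> (chosen_arm \<mu> \<pi> t) (num_pulls \<mu> \<pi> (chosen_arm \<mu> \<pi> t) t) \<le> 1" if "t \<in> {1..T}" for t
  proof -
    have "t \<in> {l \<in> {1..t}. chosen_arm \<mu> \<pi> l = chosen_arm \<mu> \<pi> t}"
      using that by auto
    then have "num_pulls \<mu> \<pi> (chosen_arm \<mu> \<pi> t) t \<noteq> 0"
      unfolding num_pulls_def by (subst card_eq_0_iff) auto
    moreover have "chosen_arm \<mu> \<pi> t \<in> {1..K}"
      using assms(2) by (simp only: chosen_arm_def policies_def mem_Collect_eq)
    ultimately show ?thesis
      using assms(1) by (simp add: deterministic_bandit_def)
  qed
  show "0 \<le> cumulative_reward \<mu> \<pi> T"
    unfolding cumulative_reward_def using * by (intro sum_nonneg) auto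
  show "cumulative_reward \<mu> \<pi> T \<le> real T"
    unfolding cumulative_reward_def using * sum_bounded_above[of "{1..T}" _ "1::real"] by auto
qed

lemma bdd_above_cumulative_reward:
  assumes "deterministic_bandit K \<mu>"
  shows "bdd_above ((\<lambda>\<pi>. cumulative_reward \<mu> \<pi> T) ` policies K)"
  using cumulative_reward_bounds(2)[OF assms] by (intro bdd_aboveI2) auto

lemma bdd_above_regret:
  assumes "\<pi> \<in> policies K"
  shows "bdd_above ((\<lambda>\<mu>. regret K \<mu> \<pi> T) ` rising_bandits K)"
proof (rule bdd_aboveI2)
  fix \<mu> assume "\<mu> \<in> rising_bandits K"
  then have \<mu>: "deterministic_bandit K \<mu>" by (simp add: rising_bandits_def)
  have "(SUP \<pi>'\<in>policies K. cumulative_reward \<mu> \<pi>' T) \<le> real T"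
    using assms cumulative_reward_bounds(2)[OF \<mu>] by (intro cSUP_least) auto
  then show "regret K \<mu> \<pi> T \<le> real T"
    using cumulative_reward_bounds(1)[OF \<mu> assms, of T] by (simp add: regret_def)
qed

end

theory Submission imports Defs begin

text \<open>
  Let \<open>m = T div 4\<close>. One arm always pays \<open>m / T\<close>; the other pays \<open>n / T\<close> at its \<open>n\<close>-th pull, growing
  either up to the level \<open>m / T\<close> only, or up to \<open>1\<close>. The two instances agree until the growing arm has
  been pulled \<open>m\<close> times. A policy that pulls it \<open>m\<close> times on the first instance has lost
  \<open>m (m - 1) / (2 T)\<close>, about \<open>T / 32\<close>, compared with the constant arm. A policy that does not
  behaves identically on the second instance, where it collects at most \<open>m\<close>, while the growing arm
  alone would have given \<open>(T + 1) / 2\<close>.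
\<close>

lemma num_pulls_Suc:
  "num_pulls \<mu> \<pi> i (Suc t) = num_pulls \<mu> \<pi> i t + (if chosen_arm \<mu> \<pi> (Suc t) = i then 1 else 0)"
proof -
  have "{l \<in> {1..Suc t}. chosen_arm \<mu> \<pi> l = i} =
        {l \<in> {1..t}. chosen_arm \<mu> \<pi> l = i} \<union> (if chosen_arm \<mu> \<pi> (Suc t) = i then {Suc t} else {})"
    by (auto simp: le_Suc_eq)
  then show ?thesis
    by (auto simp: num_pulls_def)
qed

lemma num_pulls_0 [simp]: "num_pulls \<mu> \<pi> i 0 = 0"
  by (simp add: num_pulls_def)

lemma num_pulls_mono: "s \<le> t \<Longrightarrow> num_pulls \<mu> \<pi> i s \<le> num_pulls \<mu> \<pi> i t"
  by (rule lift_Suc_mono_le[where f = "num_pulls \<mu> \<pi> i"]) (simp_all add: num_pulls_Suc)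

lemma chosen_arm_in:
  assumes "\<pi> \<in> policies K"
  shows "chosen_arm \<mu> \<pi> t \<in> {1..K}"
  using assms by (simp only: chosen_arm_def policies_def mem_Collect_eq)

lemma sum_num_pulls:
  assumes "\<pi> \<in> policies K"
  shows "(\<Sum>i = 1..K. num_pulls \<mu> \<pi> i t) = t"
proof (induction t)
  case (Suc t)
  then show ?case
    using chosen_arm_in[OF assms, of \<mu> "Suc t"] by (simp add: num_pulls_Suc sum.distrib)
qed simp

text \<open>The arms are rested: each pull uses up the next entry of its own arm, so the order of
  the pulls does not affect the total.\<close>

lemma cumulative_reward_eq_sum_arms:
  assumes "\<pi> \<in> policies K"
  shows "cumulative_reward \<mu> \<pi> t = (\<Sum>i = 1..K. \<Sum>n = 1..num_pulls \<mu> \<pi> i t. \<mu> i n)"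
proof (induction t)
  case 0
  then show ?case by (simp add: cumulative_reward_def)
next
  case (Suc t)
  define a where "a = chosen_arm \<mu> \<pi> (Suc t)"
  have "(\<Sum>n = 1..num_pulls \<mu> \<pi> i (Suc t). \<mu> i n) =
        (\<Sum>n = 1..num_pulls \<mu> \<pi> i t. \<mu> i n) + (if a = i then \<mu> a (num_pulls \<mu> \<pi> a (Suc t)) else 0)" for i
    by (simp add: num_pulls_Suc a_def)
  then show ?case
    using Suc chosen_arm_in[OF assms, of \<mu> "Suc t"]
    by (simp add: cumulative_reward_def sum.distrib flip: a_def)
qed

text \<open>By induction on rounds, the policy sees the same past in both bandits and so picks the
  same arm, whose next entry lies within the pulls made up to \<open>T\<close>. Counts under
  \<open>\<mu>\<close> alone thus delimit where agreement is required.\<close>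

lemma history_cong:
  assumes "\<pi> \<in> policies K"
    and agree: "\<And>i n. i \<in> {1..K} \<Longrightarrow> 1 \<le> n \<Longrightarrow> n \<le> num_pulls \<mu> \<pi> i T \<Longrightarrow> \<mu> i n = \<mu>' i n"
    and "t \<le> T"
  shows "history \<mu>' \<pi> t = history \<mu> \<pi> t"
  using \<open>t \<le> T\<close>
proof (induction t)
  case (Suc t)
  define h where "h = history \<mu> \<pi> t"
  have a: "chosen_arm \<mu> \<pi> (Suc t) = \<pi> h"
    by (simp add: chosen_arm_def h_def)
  have "pulls (\<pi> h) h + 1 = num_pulls \<mu> \<pi> (\<pi> h) (Suc t)"
    by (simp add: num_pulls_Suc a pulls_history h_def)
  moreover have "\<dots> \<le> num_pulls \<mu> \<pi> (\<pi> h) T"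
    using Suc.prems by (rule num_pulls_mono)
  moreover have "\<pi> h \<in> {1..K}"
    using chosen_arm_in[OF assms(1), of \<mu> "Suc t"] unfolding a .
  ultimately have "\<mu> (\<pi> h) (pulls (\<pi> h) h + 1) = \<mu>' (\<pi> h) (pulls (\<pi> h) h + 1)"
    by (intro agree) auto
  then show ?case
    using Suc by (simp add: Let_def h_def)
qed simp

lemma cumulative_reward_cong:
  assumes "\<pi> \<in> policies K"
    and agree: "\<And>i n. i \<in> {1..K} \<Longrightarrow> 1 \<le> n \<Longrightarrow> n \<le> num_pulls \<mu> \<pi> i T \<Longrightarrow> \<mu> i n = \<mu>' i n"
  shows "cumulative_reward \<mu>' \<pi> T = cumulative_reward \<mu> \<pi> T"
proof -
  have "num_pulls \<mu>' \<pi> i T = num_pulls \<mu> \<pi> i T" for i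
    using history_cong[where \<mu>' = \<mu>', OF assms order_refl] by (simp flip: pulls_history)
  then show ?thesis
    by (auto simp: cumulative_reward_eq_sum_arms[OF assms(1)] agree intro!: sum.cong)
qed

lemma cumulative_reward_const_policy:
  "cumulative_reward \<mu> (\<lambda>_. i) t = (\<Sum>n = 1..t. \<mu> i n)"
proof -
  have "num_pulls \<mu> (\<lambda>_. i) i s = s" for s
    by (induction s) (simp_all add: num_pulls_Suc chosen_arm_def)
  then show ?thesis
    by (simp add: cumulative_reward_def chosen_arm_def)
qed

lemma regret_ge:
  assumes "\<mu> \<in> rising_bandits K" "\<pi>' \<in> policies K"
  shows "cumulative_reward \<mu> \<pi>' T - cumulative_reward \<mu> \<pi> T \<le> regret K \<mu> \<pi> T"
  using assms cSUP_upper[OF assms(2) bdd_above_cumulative_reward[of K \<mu> T]]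
  by (simp add: regret_def rising_bandits_def)

lemma sup_regret_ge:
  assumes "\<pi> \<in> policies K" "\<mu> \<in> rising_bandits K" "\<pi>' \<in> policies K"
    and "x \<le> cumulative_reward \<mu> \<pi>' T - cumulative_reward \<mu> \<pi> T"
  shows "x \<le> (SUP \<mu>\<in>rising_bandits K. regret K \<mu> \<pi> T)"
  using assms(4) regret_ge[OF assms(2,3), of T \<pi>]
    cSUP_upper[OF assms(2) bdd_above_regret[OF assms(1), of T]]
  by linarith

text \<open>The cap \<open>M\<close> separates the two instances: \<open>M = m\<close> stops the
  growth at the level of arm 1, \<open>M = T\<close> lets it reach 1. A cap of at most
  \<open>T\<close> also keeps rewards within [0,1] at pulls beyond the horizon.\<close>

definition ramp_bandit :: "nat \<Rightarrow> nat \<Rightarrow> nat \<Rightarrow> bandit" where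
  "ramp_bandit T m M i n = real (if i = 1 then m else min n M) / real T"

lemma ramp_bandit_rising:
  assumes "m \<le> T" "M \<le> T"
  shows "ramp_bandit T m M \<in> rising_bandits K"
proof -
  have "increment (ramp_bandit T m M) i n =
        (if i = 1 \<or> M \<le> n then 0 else 1 / real T)" for i n
    by (auto simp: increment_def ramp_bandit_def min_def not_le field_simps simp flip: diff_divide_distrib)
  then have "rising K (ramp_bandit T m M)"
    by (auto simp: rising_def)
  moreover have "deterministic_bandit K (ramp_bandit T m M)"
    using assms by (auto simp: deterministic_bandit_def ramp_bandit_def divide_le_eq_1)
  ultimately show ?thesis
    by (simp add: rising_bandits_def)
qed

lemma sum_real_gauss: "(\<Sum>n = 1..m. real n) = real m * (real m + 1) / 2"
  by (induction m) (simp_all add: field_simps)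

theorem theorem4p3:
  fixes T :: nat and \<pi> :: policy
  assumes "T \<ge> 1" and "\<pi> \<in> policies 2"
  shows "(SUP \<mu>\<in>rising_bandits 2. regret 2 \<mu> \<pi> T) \<ge> real_of_int \<lfloor>real T / 64\<rfloor>"
proof (cases "T < 64")
  case True
  then have "\<lfloor>real T / 64\<rfloor> = 0"
    by (simp add: floor_eq_iff)
  \<comment> \<open>The bound is 0, so comparing \<open>\<pi>\<close> with itself on the zero bandit
    suffices.\<close>
  then show ?thesis
    using sup_regret_ge[OF assms(2) ramp_bandit_rising[of 0 T 0] assms(2), of 0 T] by simp
next
  case False
  define m where "m = T div 4"
  define A where "A = ramp_bandit T m m"
  define B where "B = ramp_bandit T m T"
  define N1 where "N1 = num_pulls A \<pi> 1 T"
  define N2 where "N2 = num_pulls A \<pi> 2 T"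
  have mT: "m \<le> T" "real m \<le> real T / 4" "(real T - 3) / 4 \<le> real m"
    by (simp_all add: m_def)
  have A: "A \<in> rising_bandits 2" and B: "B \<in> rising_bandits 2"
    using mT by (simp_all add: A_def B_def ramp_bandit_rising)
  have p: "(\<lambda>_. 1) \<in> policies 2" "(\<lambda>_. 2) \<in> policies 2"
    by (simp_all add: policies_def)
  have two: "{1..2::nat} = {1, 2}"
    by auto
  have N: "real N1 + real N2 = real T"
    using sum_num_pulls[OF assms(2), of A T] unfolding N1_def N2_def two
    by (simp flip: of_nat_add)
  have "cumulative_reward A \<pi> T
        = (\<Sum>n = 1..N1. real m / real T) + (\<Sum>n = 1..N2. real (min n m) / real T)"
    unfolding cumulative_reward_eq_sum_arms[OF assms(2)] two
    by (simp add: N1_def N2_def) (simp add: A_def ramp_bandit_def)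
  \<comment> \<open>Here \<open>real m\<close> is the reward of always playing arm 1, and the sum is
    the shortfall against it. Its terms are nonnegative, which also yields the upper bound
    \<open>m\<close> used in the second case.\<close>
  also have "\<dots> = real m - (\<Sum>n = 1..N2. (real m - real (min n m)) / real T)"
  proof -
    have "real N1 * real m / real T + real N2 * real m / real T = real m"
      using \<open>T \<ge> 1\<close> by (simp add: N flip: add_divide_distrib distrib_right)
    then show ?thesis
      by (simp add: diff_divide_distrib sum_subtractf)
  qed
  finally have JA: "cumulative_reward A \<pi> T = \<dots>" .
  have "real_of_int \<lfloor>real T / 64\<rfloor> \<le> real T / 64"
    by (rule of_int_floor_le)
  also have "\<dots> \<le> (SUP \<mu>\<in>rising_bandits 2. regret 2 \<mu> \<pi> T)"
  proof (cases "m \<le> N2")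
    case True
    have "real T / 64 \<le> real m * (real m - 1) / (2 * real T)"
    proof -
      \<comment> \<open>After the rounding in \<open>T div 4\<close>, the goal reduces to T^2 <= 2
        (T - 3) (T - 7), that is 20 T <= T^2 + 42, which T >= 64 gives.\<close>
      have "((real T - 3) / 4) * ((real T - 3) / 4 - 1) \<le> real m * (real m - 1)"
        using mT False by (intro mult_mono) auto
      moreover have "real T * 64 \<le> real T * real T"
        using False by (intro mult_left_mono) auto
      ultimately have "real T * real T \<le> 32 * (real m * (real m - 1))"
        by (simp add: field_simps)
      then show ?thesis
        using \<open>T \<ge> 1\<close> by (simp add: field_simps)
    qed
    also have "\<dots> = (\<Sum>n = 1..m. (real m - real (min n m)) / real T)"
    proof -
      have "(\<Sum>n = 1..m. (real m - real (min n m)) / real T) = (\<Sum>n = 1..m. real m - real n) / real T"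
        by (simp add: sum_divide_distrib)
      also have "(\<Sum>n = 1..m. real m - real n) = real m * (real m - 1) / 2"
        by (simp only: sum_subtractf sum_real_gauss) (simp add: field_simps)
      finally show ?thesis
        by simp
    qed
    also have "\<dots> \<le> (\<Sum>n = 1..N2. (real m - real (min n m)) / real T)"
      using True by (intro sum_mono2) auto
    also have "\<dots> = cumulative_reward A (\<lambda>_. 1) T - cumulative_reward A \<pi> T"
      using \<open>T \<ge> 1\<close> unfolding JA cumulative_reward_const_policy by (simp add: A_def ramp_bandit_def)
    finally show ?thesis
      by (rule sup_regret_ge[OF assms(2) A p(1)])
  next
    case below: False
    have "cumulative_reward B \<pi> T = cumulative_reward A \<pi> T"
    \<comment> \<open>Arm 2 is pulled fewer than \<open>m\<close> times under \<open>A\<close>, so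
      neither the cap \<open>m\<close> nor the cap \<open>T\<close> has taken effect on the entries
      seen.\<close>
    proof (rule cumulative_reward_cong[OF assms(2)])
      fix i n assume "i \<in> {1..2::nat}" "1 \<le> n" "n \<le> num_pulls A \<pi> i T"
      then show "A i n = B i n"
        using below mT(1) unfolding two by (auto simp: A_def B_def ramp_bandit_def N2_def)
    qed
    also have "\<dots> \<le> real m"
      unfolding JA by (simp add: sum_nonneg)
    finally have "cumulative_reward B \<pi> T \<le> real T / 4"
      using mT by simp
    moreover have "cumulative_reward B (\<lambda>_. 2) T = (real T + 1) / 2"
    proof -
      have "cumulative_reward B (\<lambda>_. 2) T = (\<Sum>n = 1..T. real n) / real T"
        unfolding cumulative_reward_const_policy sum_divide_distrib
        by (intro sum.cong) (auto simp: B_def ramp_bandit_def)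
      then show ?thesis
        using \<open>T \<ge> 1\<close> by (simp only: sum_real_gauss) simp
    qed
    \<comment> \<open>The gap is at least (T + 1) / 2 - T / 4, well above T / 64.\<close>
    ultimately show ?thesis
      by (intro sup_regret_ge[OF assms(2) B p(2)]) simp
  qed
  finally show ?thesis .
qed

end
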